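(* Let $\mathcal A$ be a finite alphabet, $X=\mathcal A^{\mathbb N}$, $T:X\to X$ the shift, and suppose that $g_i:\mathcal A\to(0,\infty)$ ($i\ge 0$, with $g_0$ a constant) satisfy $$\sum_{i=0}^\infty\sum_{k=i}^\infty\log\max\{\|g_k\|_\infty,\|g_k^{-1}\|_\infty\}<\infty .$$ Then there exists exactly one conformal measure for the product type function $g(x)=g_0\prod_{i=1}^\infty g_i(x_i)$, $x=(x_i)_{i\ge1}\in X$. Moreover, this measure is ergodic.
   Context: $X=\mathcal A^{\mathbb N}$ carries the product topology and its Borel $\sigma$-algebra; $T(x_1,x_2,\ldots)=(x_2,x_3,\ldots)$. For $\phi:X\to(0,\infty)$, a Borel probability measure $\mu$ on $X$ is conformal for $\phi$ ($\phi$-conformal) if there exists $\lambda>0$ such that $\mu(T(A))=\lambda\int_A\phi\,d\mu$ for all measurable sets $A$ such that $T|_A$ is injective. A (not necessarily $T$-invariant) probability measure $\nu$ on $X$ is called ergodic if every measurable $A$ with $T^{-1}(A)=A$ satisfies $\nu(A)\in\{0,1\}$. *)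

theory Defs
  imports "HOL-Probability.Probability"
begin

text \<open>
  The alphabet is a type of class \<open>{finite, discrete_topology}\<close>, so the topology on
  \<open>nat \<Rightarrow> 'a\<close> from \<open>Function_Topology\<close> is the product of discrete topologies and
  \<open>borel\<close> is its Borel sigma-algebra. Sequences are indexed from 0: the coordinate written
  \<open>x\<^sub>i\<close> with \<open>i \<ge> 1\<close> is \<open>x (i - 1)\<close>.
\<close>

definition shift_map :: "(nat \<Rightarrow> 'a) \<Rightarrow> (nat \<Rightarrow> 'a)" where
  "shift_map x = (\<lambda>n. x (Suc n))"

text \<open>
  On every Borel set \<open>A\<close> on which the shift is injective, \<open>shift_map ` A\<close> is again Borel, so
  \<open>emeasure\<close> does not take its default value there. The integral of the positive function
  \<open>\<phi>\<close> is the nonnegative one, so no integrability is presupposed.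
\<close>

definition conformal_measure ::
    "((nat \<Rightarrow> 'a::{finite, discrete_topology}) \<Rightarrow> real) \<Rightarrow> (nat \<Rightarrow> 'a) measure \<Rightarrow> bool" where
  "conformal_measure \<phi> \<mu> \<longleftrightarrow>
     prob_space \<mu> \<and> sets \<mu> = sets borel \<and>
     (\<exists>c::real. c > 0 \<and>
       (\<forall>A \<in> sets borel. inj_on shift_map A \<longrightarrow>
          emeasure \<mu> (shift_map ` A) = ennreal c * (\<integral>\<^sup>+x\<in>A. ennreal (\<phi> x) \<partial>\<mu>)))"

definition ergodic_measure :: "(nat \<Rightarrow> 'a::{finite, discrete_topology}) measure \<Rightarrow> bool" where
  "ergodic_measure \<nu> \<longleftrightarrow>
     prob_space \<nu> \<and> sets \<nu> = sets borel \<and>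
     (\<forall>A \<in> sets borel. shift_map -` A = A \<longrightarrow> measure \<nu> A \<in> {0, 1})"

definition sup_norm :: "('a \<Rightarrow> real) \<Rightarrow> real" where
  "sup_norm f = (SUP a. \<bar>f a\<bar>)"

definition product_type_function ::
    "real \<Rightarrow> (nat \<Rightarrow> 'a \<Rightarrow> real) \<Rightarrow> (nat \<Rightarrow> 'a) \<Rightarrow> real" where
  "product_type_function g0 g x = g0 * (\<Prod>i. g (Suc i) (x i))"

end

theory Submission
  imports Defs
begin

text \<open>
  Put \<open>h\<^sub>i = 1 / g\<^sub>i\<close>, \<open>H\<^sub>m = h\<^sub>1 \<cdots> h\<^sub>m\<close> and let
  \<open>p\<^sub>m\<close> be the probability vector proportional to \<open>H\<^sub>m\<close>. Conformality
  expresses \<open>\<mu>\<close> on the cylinder of a first letter through \<open>\<mu>\<close> on the whole space;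
  iterating this \<open>n\<close> times, the product form of \<open>g\<close> separates the weight
  \<open>H\<^sub>1(w\<^sub>1) \<cdots> H\<^sub>n(w\<^sub>n)\<close> of the word from a function of the shifted point.
  Hence any conformal measure is the product of the \<open>p\<^sub>m\<close>, and even
  \<open>\<mu>(A \<inter> [w]) = \<mu>(A) p\<^sub>1(w\<^sub>1) \<cdots> p\<^sub>n(w\<^sub>n)\<close> for invariant \<open>A\<close>, so
  that \<open>A\<close> is independent of itself. Conversely the product of the \<open>p\<^sub>m\<close> is conformal
  because \<open>p\<^sub>m\<^sub>+\<^sub>1 g\<^sub>m\<^sub>+\<^sub>1\<close> is proportional to \<open>p\<^sub>m\<close>.
\<close>

section \<open>Cylinders\<close>

definition cylinder :: "nat \<Rightarrow> (nat \<Rightarrow> 'a) \<Rightarrow> (nat \<Rightarrow> 'a) set" where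
  "cylinder n w = {x. \<forall>i<n. x i = w i}"

lemma cylinder_0 [simp]: "cylinder 0 w = UNIV"
  by (simp add: cylinder_def)

lemma shift_map_case_nat [simp]: "shift_map (case_nat a x) = x"
  by (simp add: shift_map_def)

lemma case_nat_shift_map: "case_nat (x 0) (shift_map x) = x"
  by (auto simp: shift_map_def fun_eq_iff split: nat.splits)

lemma funpow_shift_map: "(shift_map ^^ n) x = (\<lambda>i. x (n + i))"
  by (induction n) (auto simp: shift_map_def)

lemma cylinder_Suc_case_nat:
  "x \<in> cylinder (Suc n) (case_nat a w) \<longleftrightarrow> x 0 = a \<and> shift_map x \<in> cylinder n w"
  by (auto simp: cylinder_def shift_map_def All_less_Suc2)

lemma measurable_coordinate [measurable]:
  "(\<lambda>x. x i) \<in> borel \<rightarrow>\<^sub>M count_space (UNIV :: 'a::{finite, discrete_topology} set)"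
proof -
  have "(\<lambda>x. x i) \<in> borel \<rightarrow>\<^sub>M (borel :: 'a measure)"
    by (intro borel_measurable_continuous_onI continuous_on_product_coordinates)
  then show ?thesis
    by (subst (asm) measurable_cong_sets[OF refl sets_borel_eq_count_space])
qed

lemma coordinate_eq_in_borel [measurable]:
  "{x :: nat \<Rightarrow> 'a::{finite, discrete_topology}. x i = a} \<in> sets borel"
proof -
  have "Measurable.pred borel (\<lambda>x :: nat \<Rightarrow> 'a. x i = a)"
    by measurable
  then show ?thesis
    by (simp add: pred_def)
qed

lemma cylinder_in_borel [measurable]:
  fixes w :: "nat \<Rightarrow> 'a::{finite, discrete_topology}"
  shows "cylinder n w \<in> sets borel"
proof -
  have "Measurable.pred borel (\<lambda>x :: nat \<Rightarrow> 'a. \<forall>i<n. x i = w i)"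
    by measurable
  then show ?thesis
    unfolding cylinder_def by (simp add: pred_def)
qed

text \<open>Only the first \<open>n\<close> letters of \<open>w\<close> matter, so lists over the
  finite alphabet already index all cylinders.\<close>

lemma countable_cylinders:
  "countable {cylinder n w |n (w :: nat \<Rightarrow> 'a::finite). True}"
proof -
  have "{cylinder n w |n (w :: nat \<Rightarrow> 'a). True} \<subseteq> range (\<lambda>xs. cylinder (length xs) ((!) xs))"
  proof (rule subsetI, elim CollectE exE conjE)
    fix C n and w :: "nat \<Rightarrow> 'a" assume "C = cylinder n w"
    then have "C = cylinder (length (map w [0..<n])) ((!) (map w [0..<n]))"
      by (simp add: cylinder_def)
    then show "C \<in> range (\<lambda>xs. cylinder (length xs) ((!) xs))"
      by (rule range_eqI)
  qed
  then show ?thesis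
    by (rule countable_subset) simp
qed

lemma open_contains_cylinder:
  fixes U :: "(nat \<Rightarrow> 'a::topological_space) set"
  assumes "open U" "x \<in> U"
  obtains n where "cylinder n x \<subseteq> U"
proof -
  have "openin (product_topology (\<lambda>i. euclidean) UNIV) U"
    using assms unfolding open_fun_def by auto
  from product_topology_open_contains_basis[OF this assms(2)]
  obtain X where X: "x \<in> (\<Pi>\<^sub>E i\<in>UNIV. X i)" "finite {i. X i \<noteq> UNIV}" "(\<Pi>\<^sub>E i\<in>UNIV. X i) \<subseteq> U"
    by auto
  from X(2) obtain n where n: "\<And>i. X i \<noteq> UNIV \<Longrightarrow> i < n"
    using finite_nat_set_iff_bounded by auto
  have "cylinder n x \<subseteq> (\<Pi>\<^sub>E i\<in>UNIV. X i)"
  proof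
    fix y assume "y \<in> cylinder n x"
    then have "y i \<in> X i" for i
      using X(1) n[of i] by (cases "X i = UNIV") (auto simp: cylinder_def PiE_iff)
    then show "y \<in> (\<Pi>\<^sub>E i\<in>UNIV. X i)" by auto
  qed
  then show thesis
    using X(3) by (intro that) (rule subset_trans)
qed

text \<open>An open set is the union of the countably many cylinders it contains. The empty set is
  adjoined to make the generator closed under intersection.\<close>

lemma sets_borel_eq_cylinders:
  "sets borel = sigma_sets UNIV (insert {} {cylinder n w |n (w :: nat \<Rightarrow> 'a::{finite, discrete_topology}). True})"
    (is "_ = sigma_sets UNIV ?E")
proof
  show "sigma_sets UNIV ?E \<subseteq> sets borel"
    by (rule sets.sigma_sets_subset[of _ borel, simplified]) auto
  have "U \<in> sigma_sets UNIV ?E" if "open U" for U :: "(nat \<Rightarrow> 'a) set"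
  proof -
    let ?C = "{C \<in> {cylinder n w |n w. True}. C \<subseteq> U}"
    have "U = \<Union>?C"
    proof (intro subset_antisym subsetI)
      fix x assume "x \<in> U"
      with \<open>open U\<close> obtain n where "cylinder n x \<subseteq> U"
        by (rule open_contains_cylinder)
      then show "x \<in> \<Union>?C"
        by (intro UnionI[of "cylinder n x"]) (auto simp: cylinder_def)
    qed auto
    moreover have "\<Union>?C \<in> sigma_sets UNIV ?E"
      by (rule sigma_sets_UNION) (auto intro!: countable_subset[OF _ countable_cylinders])
    ultimately show ?thesis by simp
  qed
  then show "sets borel \<subseteq> sigma_sets UNIV ?E"
    unfolding sets_borel by (intro sigma_sets_mono) auto
qed

lemma cylinder_Int:
  "m \<le> n \<Longrightarrow> cylinder m v \<inter> cylinder n w = (if \<forall>i<m. v i = w i then cylinder n w else {})"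
proof (cases "\<forall>i<m. v i = w i")
  case True
  then show "m \<le> n \<Longrightarrow> ?thesis"
    by (auto simp: cylinder_def)
next
  case False
  then show "m \<le> n \<Longrightarrow> ?thesis"
    by (simp add: cylinder_def set_eq_iff) (metis order.strict_trans2)
qed

lemma Int_stable_cylinders:
  "Int_stable (insert {} {cylinder n w |n (w :: nat \<Rightarrow> 'a). True})"
proof -
  have "cylinder m v \<inter> cylinder n w \<in> insert {} {cylinder n w |n (w :: nat \<Rightarrow> 'a). True}" for m n v w
  proof (cases "m \<le> n")
    case True
    then show ?thesis by (auto simp: cylinder_Int)
  next
    case False
    then show ?thesis by (subst Int_commute) (auto simp: cylinder_Int)
  qed
  then show ?thesis
    by (intro Int_stableI) (elim insertE CollectE exE, simp_all)
qed

text \<open>This is the pi-lambda uniqueness argument; the cylinder of length 0 is the whole space,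
  on which \<open>M\<close> is finite.\<close>

lemma measure_eqI_cylinder:
  fixes M N :: "(nat \<Rightarrow> 'a::{finite, discrete_topology}) measure"
  assumes "sets M = sets borel" "sets N = sets borel" "finite_measure M"
    and eq: "\<And>n w. emeasure M (cylinder n w) = emeasure N (cylinder n w)"
  shows "M = N"
proof (rule measure_eqI_generator_eq[OF Int_stable_cylinders, where A = "\<lambda>_. UNIV"])
  interpret M: finite_measure M by fact
  show "emeasure M (UNIV :: (nat \<Rightarrow> 'a) set) \<noteq> \<infinity>" by simp
  show "range (\<lambda>i::nat. UNIV) \<subseteq> insert {} {cylinder n w |n (w :: nat \<Rightarrow> 'a). True}"
    by (rule image_subsetI, rule insertI2, rule CollectI) (intro exI[of _ 0] exI conjI TrueI cylinder_0[symmetric])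
  show "emeasure M X = emeasure N X" if "X \<in> insert {} {cylinder n w |n w. True}" for X
    using that eq by auto
qed (simp_all only: assms(1,2) sets_borel_eq_cylinders, auto)

lemma measurable_shift_map [measurable]:
  "shift_map \<in> borel \<rightarrow>\<^sub>M (borel :: (nat \<Rightarrow> 'a::{finite, discrete_topology}) measure)"
  unfolding shift_map_def
  by (intro borel_measurable_continuous_onI continuous_on_coordinatewise_then_product
      continuous_on_product_coordinates)

lemma measurable_case_nat_const [measurable]:
  "case_nat a \<in> borel \<rightarrow>\<^sub>M (borel :: (nat \<Rightarrow> 'a::{finite, discrete_topology}) measure)"
proof (intro borel_measurable_continuous_onI continuous_on_coordinatewise_then_product)
  show "continuous_on UNIV (\<lambda>x. case i of 0 \<Rightarrow> a | Suc j \<Rightarrow> x j)" for i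
    by (cases i) auto
qed

section \<open>Conformal measures\<close>

text \<open>The shift maps the points with first letter \<open>a\<close> bijectively onto the whole
  space, so \<mu> is the image of a density on these points. Stated for integrals, this can be
  iterated.\<close>

lemma conformal_measure_nn_integral:
  fixes \<phi> :: "(nat \<Rightarrow> 'a::{finite, discrete_topology}) \<Rightarrow> real"
  assumes "conformal_measure \<phi> \<mu>" and [measurable]: "\<phi> \<in> borel_measurable borel"
  obtains c :: real where "c > 0"
    and "\<And>a f. f \<in> borel_measurable borel \<Longrightarrow>
      (\<integral>\<^sup>+x. f x \<partial>\<mu>) = (\<integral>\<^sup>+x. ennreal c * ennreal (\<phi> x) * indicator {x. x 0 = a} x * f (shift_map x) \<partial>\<mu>)"
proof -
  from assms(1) have [measurable_cong]: "sets \<mu> = sets borel"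
    by (simp add: conformal_measure_def)
  then have [simp]: "space \<mu> = UNIV"
    by (auto dest: sets_eq_imp_space_eq)
  obtain c :: real where c: "c > 0"
    "\<And>A. A \<in> sets borel \<Longrightarrow> inj_on shift_map A \<Longrightarrow>
          emeasure \<mu> (shift_map ` A) = ennreal c * (\<integral>\<^sup>+x\<in>A. ennreal (\<phi> x) \<partial>\<mu>)"
    using assms(1) by (auto simp: conformal_measure_def)
  have *: "\<mu> = distr (density \<mu> (\<lambda>x. ennreal c * ennreal (\<phi> x) * indicator {x. x 0 = a} x)) borel shift_map"
    (is "_ = ?N") for a
  proof (rule measure_eqI)
    fix B assume "B \<in> sets \<mu>"
    then have B [measurable]: "B \<in> sets borel" by (simp add: \<open>sets \<mu> = sets borel\<close>)
    let ?A = "{x. x 0 = a} \<inter> shift_map -` B"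
    have A [measurable]: "?A \<in> sets borel"
      using measurable_sets_borel[OF measurable_shift_map B] by auto
    have "case_nat a (shift_map x) = x" if "x \<in> ?A" for x
      using that case_nat_shift_map[of x] by simp
    then have "inj_on shift_map ?A"
      by (intro inj_on_inverseI[of _ "case_nat a"]) simp
    moreover have "shift_map ` ?A = B"
      by (auto intro!: image_eqI[of _ shift_map "case_nat a _"])
    ultimately have "emeasure \<mu> B = ennreal c * (\<integral>\<^sup>+x\<in>?A. ennreal (\<phi> x) \<partial>\<mu>)"
      using c(2)[OF A] by simp
    also have "\<dots> = (\<integral>\<^sup>+x. ennreal c * ennreal (\<phi> x) * indicator {x. x 0 = a} x * indicator (shift_map -` B) x \<partial>\<mu>)"
      by (subst nn_integral_cmult[symmetric]) (auto simp: indicator_def intro!: nn_integral_cong)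
    also have "\<dots> = emeasure ?N B"
      by (subst emeasure_distr)
         (use measurable_sets_borel[OF measurable_shift_map B] in \<open>auto simp: emeasure_density\<close>)
    finally show "emeasure \<mu> B = emeasure ?N B" .
  qed (simp add: \<open>sets \<mu> = sets borel\<close>)
  show thesis
  proof (rule that[OF c(1)])
    fix a and f :: "(nat \<Rightarrow> 'a) \<Rightarrow> ennreal" assume [measurable]: "f \<in> borel_measurable borel"
    show "(\<integral>\<^sup>+x. f x \<partial>\<mu>) = (\<integral>\<^sup>+x. ennreal c * ennreal (\<phi> x) * indicator {x. x 0 = a} x * f (shift_map x) \<partial>\<mu>)"
      by (subst *[of a]) (simp add: nn_integral_distr nn_integral_density)
  qed
qed

text \<open>For each first letter, cylinders determine the two measures being compared; an arbitrary
  \<open>A\<close> is then cut into finitely many pieces by first letter.\<close>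

lemma conformal_measureI:
  fixes \<phi> :: "(nat \<Rightarrow> 'a::{finite, discrete_topology}) \<Rightarrow> real"
  assumes "prob_space \<nu>" and sets_\<nu>[measurable_cong]: "sets \<nu> = sets borel"
    and [measurable]: "\<phi> \<in> borel_measurable borel" and "c > 0"
    and cyl: "\<And>a n w. emeasure \<nu> (cylinder n w) =
      ennreal c * (\<integral>\<^sup>+x\<in>cylinder (Suc n) (case_nat a w). ennreal (\<phi> x) \<partial>\<nu>)"
  shows "conformal_measure \<phi> \<nu>"
proof -
  have [simp]: "space \<nu> = UNIV"
    using sets_eq_imp_space_eq[OF sets_\<nu>] by auto
  let ?N = "\<lambda>a. distr (density \<nu> (\<lambda>x. ennreal c * ennreal (\<phi> x) * indicator {x. x 0 = a} x)) borel shift_map"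
  have N: "emeasure (?N a) B = ennreal c * (\<integral>\<^sup>+x\<in>{x. x 0 = a} \<inter> shift_map -` B. ennreal (\<phi> x) \<partial>\<nu>)"
    if [measurable]: "B \<in> sets borel" for a B
  proof -
    have [measurable]: "shift_map -` B \<in> sets borel"
      using measurable_sets_borel[OF measurable_shift_map that] by auto
    show ?thesis
      by (subst nn_integral_cmult[symmetric])
         (auto simp: emeasure_distr emeasure_density indicator_def intro!: nn_integral_cong)
  qed
  have *: "\<nu> = ?N a" for a
  proof (rule measure_eqI_cylinder)
    show "finite_measure \<nu>" using \<open>prob_space \<nu>\<close> by (rule prob_space.finite_measure)
    have "cylinder (Suc n) (case_nat a w) = {x. x 0 = a} \<inter> shift_map -` cylinder n w" for n w
      by (auto simp: cylinder_Suc_case_nat)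
    then show "emeasure \<nu> (cylinder n w) = emeasure (?N a) (cylinder n w)" for n w
      using cyl[of n w a] N[OF cylinder_in_borel, of a n w] by simp
  qed (auto simp: sets_\<nu>)
  have "emeasure \<nu> (shift_map ` A) = ennreal c * (\<integral>\<^sup>+x\<in>A. ennreal (\<phi> x) \<partial>\<nu>)"
    if A [measurable]: "A \<in> sets borel" and inj: "inj_on shift_map A" for A
  proof -
    \<comment> \<open>\<open>?B a\<close> is the shifted image of the points of \<open>A\<close>
      that begin with \<open>a\<close>; injectivity of the shift on \<open>A\<close> makes these
      images disjoint.\<close>
    let ?B = "\<lambda>a. case_nat a -` A"
    have B: "?B a \<in> sets borel" for a
      using measurable_sets_borel[OF measurable_case_nat_const A] by auto
    have "shift_map ` A = (\<Union>a. ?B a)"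
    proof (intro set_eqI iffI)
      fix y assume "y \<in> shift_map ` A"
      then obtain x where "x \<in> A" "y = shift_map x" by auto
      then have "y \<in> ?B (x 0)" by (simp add: case_nat_shift_map)
      then show "y \<in> (\<Union>a. ?B a)" by blast
    next
      fix y assume "y \<in> (\<Union>a. ?B a)"
      then obtain a where "case_nat a y \<in> A" by auto
      then show "y \<in> shift_map ` A"
        by (intro image_eqI[of _ shift_map "case_nat a y"]) simp_all
    qed
    moreover have "disjoint_family ?B"
      unfolding disjoint_family_on_def
    proof (rule ballI, rule ballI, rule impI)
      fix a b :: 'a assume "a \<noteq> b"
      have False if "case_nat a y \<in> A" "case_nat b y \<in> A" for y
      proof -
        have "case_nat a y = case_nat b y"
          by (rule inj_onD[OF inj _ that]) simp
        from fun_cong[OF this, of 0] \<open>a \<noteq> b\<close> show False by simp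
      qed
      then show "?B a \<inter> ?B b = {}" by blast
    qed
    ultimately have "emeasure \<nu> (shift_map ` A) = (\<Sum>a\<in>UNIV. emeasure \<nu> (?B a))"
      using B sets_\<nu> by (subst sum_emeasure) auto
    also have "\<dots> = (\<Sum>a\<in>UNIV. ennreal c * (\<integral>\<^sup>+x\<in>{x. x 0 = a} \<inter> A. ennreal (\<phi> x) \<partial>\<nu>))"
    proof (rule sum.cong)
      fix a :: 'a
      have "{x. x 0 = a} \<inter> shift_map -` ?B a = {x. x 0 = a} \<inter> A"
        by (auto simp: case_nat_shift_map)
      then show "emeasure \<nu> (?B a) = ennreal c * (\<integral>\<^sup>+x\<in>{x. x 0 = a} \<inter> A. ennreal (\<phi> x) \<partial>\<nu>)"
        using trans[OF arg_cong[OF *[of a], of "\<lambda>M. emeasure M (?B a)"] N[OF B[of a], of a]] by simp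
    qed simp
    also have "\<dots> = ennreal c * (\<integral>\<^sup>+x. (\<Sum>a\<in>UNIV. ennreal (\<phi> x) * indicator ({x. x 0 = a} \<inter> A) x) \<partial>\<nu>)"
      by (subst nn_integral_sum) (auto simp: sum_distrib_left)
    also have "\<dots> = ennreal c * (\<integral>\<^sup>+x\<in>A. ennreal (\<phi> x) \<partial>\<nu>)"
      by (intro arg_cong2[where f = "(*)"] nn_integral_cong)
         (simp_all add: indicator_inter_arith mult.assoc[symmetric] sum_distrib_left[symmetric]
            sum_distrib_right[symmetric], simp add: indicator_def)
    finally show ?thesis .
  qed
  then show ?thesis
    unfolding conformal_measure_def using assms(1,2,4) by blast
qed

section \<open>Product potentials\<close>

text \<open>Logarithms turn the infinite product into \<open>exp\<close> of an absolutely convergent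
  series; \<open>s\<close> is the constant factor.\<close>

locale product_potential =
  fixes l :: "nat \<Rightarrow> 'a::{finite, discrete_topology} \<Rightarrow> real" and b :: "nat \<Rightarrow> real" and s :: real
  assumes s_pos: "s > 0" and l_le: "\<And>i a. \<bar>l i a\<bar> \<le> b i" and summable_b: "summable b"
begin

text \<open>
  With \<open>l i = ln g\<^sub>i\<^sub>+\<^sub>1\<close>, the \<open>weight m\<close> and \<open>marginal m\<close> below are \<open>H\<^sub>m\<^sub>+\<^sub>1\<close> and
  \<open>p\<^sub>m\<^sub>+\<^sub>1\<close>.
\<close>

definition tail_sum :: "nat \<Rightarrow> (nat \<Rightarrow> 'a) \<Rightarrow> real" where
  "tail_sum j x = (\<Sum>i. l (i + j) (x i))"

definition pot :: "(nat \<Rightarrow> 'a) \<Rightarrow> real" where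
  "pot x = s * exp (tail_sum 0 x)"

definition weight :: "nat \<Rightarrow> 'a \<Rightarrow> real" where
  "weight m a = exp (- (\<Sum>i\<le>m. l i a))"

definition normalizer :: "nat \<Rightarrow> real" where
  "normalizer m = (\<Sum>a\<in>UNIV. weight m a)"

definition marginal :: "nat \<Rightarrow> 'a \<Rightarrow> real" where
  "marginal m a = weight m a / normalizer m"

lemma summable_l: "summable (\<lambda>i. l (i + j) (x i))"
proof (rule summable_comparison_test')
  show "summable (\<lambda>i. b (i + j))"
    using summable_b by (simp add: summable_iff_shift)
  show "norm (l (i + j) (x i)) \<le> b (i + j)" for i
    using l_le by simp
qed

lemma tail_sum_case_nat: "tail_sum j (case_nat a x) = l j a + tail_sum (Suc j) x"
  using suminf_split_head[OF summable_l[of j "case_nat a x"]]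
  by (simp add: tail_sum_def)

lemma measurable_tail_sum [measurable]: "tail_sum j \<in> borel_measurable borel"
proof -
  have "(\<lambda>x. l i (x k)) \<in> borel_measurable borel" for i k
    by (rule measurable_compose[OF measurable_coordinate]) simp
  then show ?thesis
    unfolding tail_sum_def[abs_def] by (intro borel_measurable_suminf)
qed

lemma measurable_pot [measurable]: "pot \<in> borel_measurable borel"
  unfolding pot_def[abs_def] by measurable

lemma weight_pos: "weight m a > 0"
  by (simp add: weight_def)

lemma normalizer_pos: "normalizer m > 0"
  unfolding normalizer_def by (intro sum_pos) (auto simp: weight_pos)

lemma marginal_pos: "marginal m a > 0"
  by (simp add: marginal_def weight_pos normalizer_pos)

lemma sum_marginal: "(\<Sum>a\<in>UNIV. marginal m a) = 1"
  using normalizer_pos[of m] by (simp add: marginal_def sum_divide_distrib[symmetric] normalizer_def)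

section \<open>Cylinder masses of conformal measures, uniqueness and ergodicity\<close>

text \<open>Conformality is applied once per letter. What matters is that \<open>K\<close> depends
  on the word only through its length.\<close>

lemma conformal_nn_integral_cylinder:
  assumes "conformal_measure pot \<mu>"
  obtains K where "\<And>f n w. f \<in> borel_measurable borel \<Longrightarrow>
    (\<integral>\<^sup>+x. f ((shift_map ^^ n) x) * indicator (cylinder n w) x \<partial>\<mu>)
      = ennreal (\<Prod>i<n. weight i (w i)) * (\<integral>\<^sup>+x. f x * K n x \<partial>\<mu>)"
proof -
  from assms have [measurable_cong]: "sets \<mu> = sets borel"
    by (simp add: conformal_measure_def)
  then have [simp]: "space \<mu> = UNIV"
    by (auto dest: sets_eq_imp_space_eq)
  obtain c :: real where c: "c > 0" and step: "\<And>a f. f \<in> borel_measurable borel \<Longrightarrow>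
      (\<integral>\<^sup>+x. f x \<partial>\<mu>) = (\<integral>\<^sup>+x. ennreal c * ennreal (pot x) * indicator {x. x 0 = a} x * f (shift_map x) \<partial>\<mu>)"
    by (rule conformal_measure_nn_integral[OF assms measurable_pot]) auto
  \<comment> \<open>If \<open>y\<close> is \<open>x\<close> with the word prepended and
    \<open>W\<close> is the weight of the word, the product of \<open>c * pot\<close> over the first
    \<open>n\<close> points of the orbit of \<open>y\<close> is
    \<open>1 / (W * K n x)\<close>.\<close>
  define K where "K n x = exp (- (\<Sum>j<n. tail_sum (Suc j) x)) / (c * s) ^ n" for n x
  have [measurable]: "K n \<in> borel_measurable borel" for n
    unfolding K_def by measurable
  have K_nonneg: "K n x \<ge> 0" for n x
    using c s_pos by (simp add: K_def)
  \<comment> \<open>The potential cancels \<open>l 0 a\<close> in \<open>weight n a\<close> and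
    \<open>tail_sum 1 x\<close> in \<open>K (Suc n) x\<close>; what remains is the effect of
    prepending \<open>a\<close> in \<open>K n\<close>.\<close>
  have K_Suc: "K n (case_nat a x) = c * pot (case_nat a x) * (weight n a * K (Suc n) x)" for n a x
  proof -
    have "exp (- (\<Sum>j<n. tail_sum (Suc j) (case_nat a x)))
        = exp (tail_sum 0 (case_nat a x)) * (weight n a * exp (- (\<Sum>j<Suc n. tail_sum (Suc j) x)))"
      unfolding weight_def
      by (simp add: exp_add[symmetric] tail_sum_case_nat sum.distrib
          lessThan_Suc_atMost[symmetric] sum.lessThan_Suc_shift del: sum.lessThan_Suc)
    then show ?thesis
      using c s_pos by (simp add: K_def pot_def)
  qed
  have "(\<integral>\<^sup>+x. f ((shift_map ^^ n) x) * indicator (cylinder n w) x \<partial>\<mu>)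
      = ennreal (\<Prod>i<n. weight i (w i)) * (\<integral>\<^sup>+x. f x * ennreal (K n x) \<partial>\<mu>)"
    if "f \<in> borel_measurable borel" for f :: "(nat \<Rightarrow> 'a) \<Rightarrow> ennreal" and n w
    using that
  proof (induction n arbitrary: f)
    case 0
    then show ?case by (simp add: K_def)
  next
    case (Suc n)
    note [measurable] = Suc.prems
    \<comment> \<open>The last letter \<open>w n\<close> is the first letter of the
      \<open>n\<close>-fold shift, so its constraint moves into the test function.\<close>
    let ?f = "\<lambda>x. f (shift_map x) * indicator {x. x 0 = w n} x"
    have "(\<integral>\<^sup>+x. f ((shift_map ^^ Suc n) x) * indicator (cylinder (Suc n) w) x \<partial>\<mu>)
        = (\<integral>\<^sup>+x. ?f ((shift_map ^^ n) x) * indicator (cylinder n w) x \<partial>\<mu>)"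
      by (intro nn_integral_cong)
         (auto simp: cylinder_def indicator_def less_Suc_eq funpow_shift_map)
    also have "\<dots> = ennreal (\<Prod>i<n. weight i (w i)) * (\<integral>\<^sup>+x. ?f x * ennreal (K n x) \<partial>\<mu>)"
      by (rule Suc.IH) measurable
    also have "(\<integral>\<^sup>+x. ?f x * ennreal (K n x) \<partial>\<mu>)
        = (\<integral>\<^sup>+x. ennreal c * ennreal (pot x) * indicator {x. x 0 = w n} x *
            (f (shift_map x) * ennreal (weight n (w n) * K (Suc n) (shift_map x))) \<partial>\<mu>)"
    proof (intro nn_integral_cong)
      fix x :: "nat \<Rightarrow> 'a"
      show "?f x * ennreal (K n x) = ennreal c * ennreal (pot x) * indicator {x. x 0 = w n} x *
            (f (shift_map x) * ennreal (weight n (w n) * K (Suc n) (shift_map x)))"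
      proof (cases "x 0 = w n")
        case True
        then have "case_nat (w n) (shift_map x) = x"
          using case_nat_shift_map[of x] by simp
        with K_Suc[of n "w n" "shift_map x"]
        have "K n x = c * pot x * (weight n (w n) * K (Suc n) (shift_map x))"
          by simp
        then have "ennreal (K n x)
            = ennreal c * ennreal (pot x) * ennreal (weight n (w n) * K (Suc n) (shift_map x))"
          using c s_pos weight_pos[of n "w n"] K_nonneg
          by (simp add: pot_def less_imp_le flip: ennreal_mult')
        with True show ?thesis by (simp add: ac_simps)
      qed simp
    qed
    also have "\<dots> = (\<integral>\<^sup>+x. f x * ennreal (weight n (w n) * K (Suc n) x) \<partial>\<mu>)"
      by (rule step[symmetric]) measurable
    also have "\<dots> = (\<integral>\<^sup>+x. ennreal (weight n (w n)) * (f x * ennreal (K (Suc n) x)) \<partial>\<mu>)"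
      by (simp add: ennreal_mult weight_pos less_imp_le K_nonneg ac_simps)
    also have "\<dots> = ennreal (weight n (w n)) * (\<integral>\<^sup>+x. f x * ennreal (K (Suc n) x) \<partial>\<mu>)"
      by (rule nn_integral_cmult) measurable
    finally show ?case
      by (simp add: ennreal_mult prod_nonneg weight_pos less_imp_le mult.assoc)
  qed
  then show thesis by (rule that)
qed

text \<open>
  The integral of \<open>K n\<close> over an invariant set does not depend on the word \<open>w\<close>; summing over
  the last letter shows that it is divided by \<open>normalizer n\<close> at each step.
\<close>

lemma conformal_cylinder_Int_invariant:
  assumes \<mu>: "conformal_measure pot \<mu>" and A [measurable]: "A \<in> sets borel"
    and inv: "shift_map -` A = A"
  shows "measure \<mu> (A \<inter> cylinder n w) = measure \<mu> A * (\<Prod>i<n. marginal i (w i))"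
proof -
  from \<mu> have sets_\<mu> [measurable_cong]: "sets \<mu> = sets borel" and "prob_space \<mu>"
    by (simp_all add: conformal_measure_def)
  interpret prob_space \<mu> by fact
  obtain K where K: "\<And>f n w. f \<in> borel_measurable borel \<Longrightarrow>
    (\<integral>\<^sup>+x. f ((shift_map ^^ n) x) * indicator (cylinder n w) x \<partial>\<mu>)
      = ennreal (\<Prod>i<n. weight i (w i)) * (\<integral>\<^sup>+x. f x * K n x \<partial>\<mu>)"
    using conformal_nn_integral_cylinder[OF \<mu>] by blast
  \<comment> \<open>Invariance lets the indicator of \<open>A\<close> be read at the
    \<open>n\<close>-fold shift, the form that \<open>K\<close> handles.\<close>
  have inv_n: "(shift_map ^^ n) x \<in> A \<longleftrightarrow> x \<in> A" for n x
    using inv by (induction n) auto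
  define d where "d n = enn2real (\<integral>\<^sup>+x. indicator A x * K n x \<partial>\<mu>)" for n
  have eq: "measure \<mu> (A \<inter> cylinder n w) = (\<Prod>i<n. weight i (w i)) * d n" for n w
  proof -
    have "emeasure \<mu> (A \<inter> cylinder n w)
        = (\<integral>\<^sup>+x. indicator A ((shift_map ^^ n) x) * indicator (cylinder n w) x \<partial>\<mu>)"
    proof -
      have "indicator A ((shift_map ^^ n) x) * indicator (cylinder n w) x
          = (indicator (A \<inter> cylinder n w) x :: ennreal)" for x
        by (simp add: indicator_def inv_n)
      then show ?thesis by (simp add: sets_\<mu>)
    qed
    also have "\<dots> = ennreal (\<Prod>i<n. weight i (w i)) * (\<integral>\<^sup>+x. indicator A x * K n x \<partial>\<mu>)"
      by (rule K) measurable
    finally show ?thesis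
      by (simp add: measure_def d_def enn2real_mult prod_nonneg weight_pos less_imp_le)
  qed
  have d_Suc: "d n = normalizer n * d (Suc n)" for n
  proof -
    fix w :: "nat \<Rightarrow> 'a"
    have "A \<inter> cylinder n w = (\<Union>a\<in>UNIV. A \<inter> cylinder (Suc n) (w(n := a)))"
      by (auto simp: cylinder_def less_Suc_eq)
    then have "measure \<mu> (A \<inter> cylinder n w) = measure \<mu> (\<Union>a\<in>UNIV. A \<inter> cylinder (Suc n) (w(n := a)))"
      by (rule arg_cong)
    also have "\<dots> = (\<Sum>a\<in>UNIV. measure \<mu> (A \<inter> cylinder (Suc n) (w(n := a))))"
      by (rule finite_measure_finite_Union)
         (auto simp: sets_\<mu> disjoint_family_on_def cylinder_def)
    finally have "(\<Prod>i<n. weight i (w i)) * d n = (\<Prod>i<n. weight i (w i)) * (normalizer n * d (Suc n))"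
      unfolding eq by (simp add: normalizer_def sum_distrib_left sum_distrib_right ac_simps)
    moreover have "(\<Prod>i<n. weight i (w i)) \<noteq> 0"
      using weight_pos by (simp add: less_imp_neq[symmetric])
    ultimately show ?thesis by simp
  qed
  \<comment> \<open>Telescoping starts from \<open>d 0\<close>, the measure of
    \<open>A\<close>.\<close>
  have "measure \<mu> A = d n * (\<Prod>i<n. normalizer i)"
  proof (induction n)
    case 0
    then show ?case using eq[of 0] by simp
  next
    case (Suc n)
    then show ?case using d_Suc[of n] by (simp add: ac_simps)
  qed
  moreover have "normalizer i \<noteq> 0" for i
    using normalizer_pos[of i] by simp
  ultimately show ?thesis
    unfolding eq by (simp add: marginal_def prod_dividef)
qed

text \<open>Since \<open>UNIV\<close> is invariant, every cylinder mass is a product of marginals,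
  the same for both measures.\<close>

lemma conformal_measure_unique:
  assumes "conformal_measure pot \<mu>" "conformal_measure pot \<nu>"
  shows "\<mu> = \<nu>"
proof -
  interpret \<mu>: prob_space \<mu> using assms by (simp add: conformal_measure_def)
  interpret \<nu>: prob_space \<nu> using assms by (simp add: conformal_measure_def)
  have sets: "sets \<mu> = sets borel" "sets \<nu> = sets borel"
    using assms by (simp_all add: conformal_measure_def)
  have [simp]: "measure \<mu> UNIV = 1" "measure \<nu> UNIV = 1"
    using \<mu>.prob_space \<nu>.prob_space sets[THEN sets_eq_imp_space_eq] by simp_all
  show ?thesis
  proof (rule measure_eqI_cylinder)
    show "emeasure \<mu> (cylinder n w) = emeasure \<nu> (cylinder n w)" for n w
      using assms[THEN conformal_cylinder_Int_invariant, of UNIV n w]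
      by (simp add: \<mu>.emeasure_eq_measure \<nu>.emeasure_eq_measure)
  qed (use sets \<mu>.finite_measure_axioms in auto)
qed

text \<open>An invariant set is independent of every cylinder, hence of every Borel set and in
  particular of itself.\<close>

lemma conformal_measure_ergodic:
  assumes \<mu>: "conformal_measure pot \<mu>"
  shows "ergodic_measure \<mu>"
proof -
  from \<mu> have sets_\<mu> [measurable_cong]: "sets \<mu> = sets borel" and "prob_space \<mu>"
    by (simp_all add: conformal_measure_def)
  interpret prob_space \<mu> by fact
  have [simp]: "measure \<mu> UNIV = 1"
    using prob_space sets_eq_imp_space_eq[OF sets_\<mu>] by simp
  have "measure \<mu> A \<in> {0, 1}" if A [measurable]: "A \<in> sets borel" and inv: "shift_map -` A = A" for A
  proof -
    \<comment> \<open>Both sides of the independence relation are measures in the second set, so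
      agreement on cylinders allows \<open>A\<close> itself to be inserted.\<close>
    let ?L = "density \<mu> (indicator A)" and ?R = "scale_measure (ennreal (measure \<mu> A)) \<mu>"
    have "?L = ?R"
    proof (rule measure_eqI_cylinder)
      show "finite_measure ?L"
        by (rule finite_measureI) (simp add: emeasure_density)
      fix n w
      have "measure \<mu> (A \<inter> cylinder n w) = measure \<mu> A * measure \<mu> (cylinder n w)"
        using conformal_cylinder_Int_invariant[OF \<mu> A inv, of n w]
          conformal_cylinder_Int_invariant[OF \<mu>, of UNIV n w] by simp
      then show "emeasure ?L (cylinder n w) = emeasure ?R (cylinder n w)"
        by (simp add: emeasure_restricted[of A] sets_\<mu> emeasure_eq_measure ennreal_mult)
    qed (simp_all add: sets_\<mu>)
    then have "emeasure ?L A = emeasure ?R A" by (rule arg_cong)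
    then have "ennreal (measure \<mu> A) = ennreal (measure \<mu> A * measure \<mu> A)"
      by (simp add: emeasure_restricted[of A] sets_\<mu> emeasure_eq_measure ennreal_mult)
    then have "measure \<mu> A = measure \<mu> A * measure \<mu> A"
      by (simp add: ennreal_inj)
    then show ?thesis by simp
  qed
  with sets_\<mu> \<open>prob_space \<mu>\<close> show ?thesis
    by (auto simp: ergodic_measure_def)
qed

section \<open>Existence: the product of the marginals\<close>

text \<open>Transport along the identity puts the product measure on the Borel sigma-algebra that
  \<open>conformal_measure\<close> demands.\<close>

definition product_measure :: "(nat \<Rightarrow> 'a) measure" where
  "product_measure = distr (PiM UNIV (\<lambda>i. point_measure UNIV (\<lambda>a. ennreal (marginal i a)))) borel (\<lambda>x. x)"

lemma prob_space_marginal: "prob_space (point_measure UNIV (\<lambda>a. ennreal (marginal i a)))"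
  by (rule prob_spaceI)
     (simp add: space_point_measure emeasure_point_measure_finite marginal_pos less_imp_le sum_marginal)

text \<open>Cylinders generate the Borel sets and are finite intersections of coordinate
  events.\<close>

lemma measurable_PiM_borel:
  "(\<lambda>x. x) \<in> PiM UNIV (\<lambda>i. point_measure UNIV (\<lambda>a. ennreal (marginal i a))) \<rightarrow>\<^sub>M borel"
    (is "_ \<in> ?P \<rightarrow>\<^sub>M _")
proof -
  have [simp]: "space ?P = UNIV"
    by (simp add: space_PiM space_point_measure)
  have "cylinder n w \<in> sets ?P" for n w
  proof -
    have "Measurable.pred ?P (\<lambda>x. x i = w i)" for i
    proof -
      have "(\<lambda>x. x i) \<in> ?P \<rightarrow>\<^sub>M point_measure UNIV (\<lambda>a. ennreal (marginal i a))"
        by (rule measurable_component_singleton) simp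
      then have "(\<lambda>x. x i) -` {w i} \<inter> space ?P \<in> sets ?P"
        by (rule measurable_sets) (simp add: sets_point_measure)
      then show ?thesis by (simp add: pred_def vimage_def)
    qed
    then have "Measurable.pred ?P (\<lambda>x. \<forall>i<n. x i = w i)"
      by measurable
    then show ?thesis
      unfolding cylinder_def by (simp add: pred_def)
  qed
  then have "(\<lambda>x. x) \<in> ?P \<rightarrow>\<^sub>M sigma UNIV (insert {} {cylinder n w |n (w :: nat \<Rightarrow> 'a). True})"
    by (intro measurable_measure_of) auto
  also have "?P \<rightarrow>\<^sub>M sigma UNIV (insert {} {cylinder n w |n (w :: nat \<Rightarrow> 'a). True}) = ?P \<rightarrow>\<^sub>M borel"
    by (rule measurable_cong_sets) (auto simp: sets_borel_eq_cylinders)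
  finally show ?thesis .
qed

lemma prob_space_product_measure: "prob_space product_measure"
  unfolding product_measure_def
  by (intro prob_space.prob_space_distr prob_space_PiM prob_space_marginal measurable_PiM_borel)

lemma sets_product_measure [measurable_cong]: "sets product_measure = sets borel"
  by (simp add: product_measure_def)

text \<open>The integrand involves finitely many coordinates, so it factors over a finite product
  space. This serves both the cylinder masses and the truncated potential.\<close>

lemma product_measure_nn_integral_prod:
  fixes q :: "nat \<Rightarrow> 'a \<Rightarrow> real"
  assumes q: "\<And>i a. q i a \<ge> 0"
  shows "(\<integral>\<^sup>+x. ennreal (\<Prod>i<n. q i (x i)) \<partial>product_measure) =
    ennreal (\<Prod>i<n. \<Sum>a\<in>UNIV. marginal i a * q i a)"
proof -
  let ?M = "\<lambda>i. point_measure UNIV (\<lambda>a. ennreal (marginal i a))"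
  interpret product_prob_space ?M UNIV
    using prob_space_marginal by (simp add: product_prob_space_def product_prob_space_axioms_def
        product_sigma_finite_def prob_space_imp_sigma_finite)
  have meas_q: "(\<lambda>a. ennreal (q i a)) \<in> borel_measurable (?M i)" for i
    by (simp add: measurable_def space_point_measure sets_point_measure)
  have "(\<lambda>x. q i (x i)) \<in> borel_measurable borel" for i
    by (rule measurable_compose[OF measurable_coordinate]) simp
  note [measurable] = this
  have "(\<integral>\<^sup>+x. ennreal (\<Prod>i<n. q i (x i)) \<partial>product_measure)
      = (\<integral>\<^sup>+x. ennreal (\<Prod>i<n. q i (x i)) \<partial>PiM UNIV ?M)"
    unfolding product_measure_def by (rule nn_integral_distr[OF measurable_PiM_borel]) measurable
  also have "\<dots> = (\<integral>\<^sup>+x. (\<Prod>i<n. ennreal (q i (restrict x {..<n} i))) \<partial>PiM UNIV ?M)"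
    by (intro nn_integral_cong) (simp add: prod_ennreal q)
  also have "\<dots> = (\<integral>\<^sup>+x. (\<Prod>i<n. ennreal (q i (x i))) \<partial>PiM {..<n} ?M)"
  proof (subst distr_PiM_restrict_finite[symmetric, of "{..<n}"])
    have "(\<lambda>x. \<Prod>i<n. ennreal (q i (x i))) \<in> borel_measurable (PiM {..<n} ?M)"
      by (intro borel_measurable_prod_ennreal measurable_compose[OF _ meas_q] measurable_component_singleton)
    then show "(\<integral>\<^sup>+x. (\<Prod>i<n. ennreal (q i (restrict x {..<n} i))) \<partial>PiM UNIV ?M) =
      (\<integral>\<^sup>+x. (\<Prod>i<n. ennreal (q i (x i))) \<partial>distr (PiM UNIV ?M) (PiM {..<n} ?M) (\<lambda>x. restrict x {..<n}))"
      by (subst nn_integral_distr[OF measurable_restrict_subset]) auto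
  qed auto
  also have "\<dots> = (\<Prod>i<n. \<integral>\<^sup>+a. ennreal (q i a) \<partial>?M i)"
    by (rule product_nn_integral_prod) (auto intro: meas_q)
  also have "\<dots> = (\<Prod>i<n. ennreal (\<Sum>a\<in>UNIV. marginal i a * q i a))"
    by (simp add: nn_integral_point_measure_finite ennreal_mult[symmetric] q marginal_pos less_imp_le sum_ennreal)
  also have "\<dots> = ennreal (\<Prod>i<n. \<Sum>a\<in>UNIV. marginal i a * q i a)"
    by (intro prod_ennreal sum_nonneg mult_nonneg_nonneg q) (simp add: marginal_pos less_imp_le)
  finally show ?thesis .
qed

text \<open>The exponents converge for each letter, and a finite sum of exponentials is positive.
  The limit determines the conformality constant.\<close>

lemma normalizer_limit:
  obtains L where "L > 0" "normalizer \<longlonglongrightarrow> L"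
proof
  have "(\<lambda>m. \<Sum>i\<le>m. l i a) \<longlonglongrightarrow> (\<Sum>i. l i a)" for a
    using summable_l[of 0 "\<lambda>_. a"] by (intro summable_LIMSEQ') simp
  then show "normalizer \<longlonglongrightarrow> (\<Sum>a\<in>UNIV. exp (- (\<Sum>i. l i a)))"
    unfolding normalizer_def[abs_def] weight_def by (intro tendsto_intros)
  show "(\<Sum>a\<in>UNIV. exp (- (\<Sum>i. l i a))) > 0"
    by (intro sum_pos) auto
qed

lemma product_measure_cylinder:
  "emeasure product_measure (cylinder n w) = ennreal (\<Prod>i<n. marginal i (w i))"
proof -
  have "emeasure product_measure (cylinder n w) =
      (\<integral>\<^sup>+x. ennreal (\<Prod>i<n. of_bool (x i = w i)) \<partial>product_measure)"
  proof -
    have "(\<Prod>i<n. of_bool (x i = w i)) = (indicator (cylinder n w) x :: real)" for x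
      unfolding cylinder_def by (induction n) (auto simp: less_Suc_eq indicator_def)
    then show ?thesis by (simp add: ennreal_indicator sets_product_measure)
  qed
  also have "\<dots> = ennreal (\<Prod>i<n. \<Sum>a\<in>UNIV. marginal i a * of_bool (a = w i))"
    by (rule product_measure_nn_integral_prod[where q = "\<lambda>i a. of_bool (a = w i)"]) simp
  finally show ?thesis by simp
qed

text \<open>
  Multiplying \<open>marginal (Suc m)\<close> by \<open>exp (l (Suc m) a)\<close> gives \<open>marginal m\<close> up to the
  factor \<open>normalizer m / normalizer (Suc m)\<close>, so the product telescopes.
\<close>

lemma prod_marginal_exp:
  "(\<Prod>i<Suc m. \<Sum>c\<in>UNIV. marginal i c * (exp (l i c) * of_bool (i < Suc n \<longrightarrow> c = case_nat a w i)))
    = (\<Prod>i<min n m. marginal i (w i)) / normalizer m"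
proof (induction m)
  case 0
  \<comment> \<open>\<open>weight 0 a\<close> cancels against \<open>exp (l 0 a)\<close>, so the
    first letter \<open>a\<close> leaves no trace.\<close>
  have "(\<Sum>c\<in>UNIV. marginal 0 c * (exp (l 0 c) * of_bool (c = a))) = marginal 0 a * exp (l 0 a)"
    by (subst sum.remove[of _ a]) auto
  then show ?case
    by (simp add: marginal_def weight_def exp_add[symmetric])
next
  case (Suc m)
  have *: "marginal (Suc m) c * exp (l (Suc m) c) = weight m c / normalizer (Suc m)" for c
    by (simp add: marginal_def weight_def exp_add[symmetric])
  \<comment> \<open>Position \<open>Suc m\<close> of \<open>case_nat a w\<close> carries
    \<open>w m\<close>. Beyond the word there is no constraint, and the sum is the bare ratio of
    normalizers.\<close>
  have "(\<Sum>c\<in>UNIV. marginal (Suc m) c * (exp (l (Suc m) c) * of_bool (Suc m < Suc n \<longrightarrow> c = w m)))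
      = (if m < n then marginal m (w m) else 1) * normalizer m / normalizer (Suc m)"
  proof (cases "m < n")
    case True
    have "(\<Sum>c\<in>UNIV. marginal (Suc m) c * (exp (l (Suc m) c) * of_bool (c = w m))) = marginal (Suc m) (w m) * exp (l (Suc m) (w m))"
      by (subst sum.remove[of _ "w m"]) auto
    also have "\<dots> = marginal m (w m) * normalizer m / normalizer (Suc m)"
      using normalizer_pos[of m] by (simp only: *) (simp add: marginal_def)
    finally show ?thesis
      using True by simp
  next
    case False
    then show ?thesis
      by (simp add: * sum_divide_distrib[symmetric] normalizer_def)
  qed
  then have "(\<Prod>i<Suc (Suc m). \<Sum>c\<in>UNIV. marginal i c * (exp (l i c) * of_bool (i < Suc n \<longrightarrow> c = case_nat a w i)))
    = (\<Prod>i<min n m. marginal i (w i)) / normalizer m * ((if m < n then marginal m (w m) else 1) * normalizer m / normalizer (Suc m))"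
    using Suc.IH by (subst prod.lessThan_Suc) simp
  moreover have "(\<Prod>i<min n m. marginal i (w i)) * (if m < n then marginal m (w m) else 1) = (\<Prod>i<min n (Suc m). marginal i (w i))"
    by (cases "m < n") (simp_all add: min_absorb1 min_absorb2)
  ultimately show ?case
    using normalizer_pos[of m] by (simp add: field_simps)
qed

text \<open>Cutting the potential off after finitely many coordinates makes its integral over a
  cylinder a telescoping product; dominated convergence restores the potential.\<close>

lemma conformal_product_measure: "conformal_measure pot product_measure"
proof -
  obtain L where L: "L > 0" "normalizer \<longlonglongrightarrow> L"
    by (rule normalizer_limit)
  have [simp]: "space product_measure = UNIV"
    using sets_eq_imp_space_eq[OF sets_product_measure] by simp
  have abs_sum: "\<bar>\<Sum>i<N. l i (x i)\<bar> \<le> suminf b" for N and x :: "nat \<Rightarrow> 'a"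
  proof -
    have "\<bar>\<Sum>i<N. l i (x i)\<bar> \<le> (\<Sum>i<N. b i)"
      by (rule order_trans[OF sum_abs]) (intro sum_mono l_le)
    also have "\<dots> \<le> suminf b"
      by (intro sum_le_suminf summable_b) (auto intro: order_trans[OF abs_ge_zero l_le])
    finally show ?thesis .
  qed
  have int: "(\<integral>\<^sup>+x\<in>cylinder (Suc n) (case_nat a w). ennreal (exp (tail_sum 0 x)) \<partial>product_measure)
      = ennreal ((\<Prod>i<n. marginal i (w i)) / L)" for a n w
  proof -
    \<comment> \<open>Each factor combines one term of the exponential with the cylinder constraint
      at that position; \<open>Suc (n + k)\<close> factors cover all constraints.\<close>
    define q where "q i c = exp (l i c) * of_bool (i < Suc n \<longrightarrow> c = case_nat a w i)" for i c
    have "(\<lambda>x. q i (x i)) \<in> borel_measurable borel" for i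
      by (rule measurable_compose[OF measurable_coordinate]) simp
    note [measurable] = this
    have q: "(\<Prod>i<Suc (n + k). q i (x i))
        = exp (\<Sum>i<Suc (n + k). l i (x i)) * indicator (cylinder (Suc n) (case_nat a w)) x" for k x
    proof (cases "x \<in> cylinder (Suc n) (case_nat a w)")
      case True
      then show ?thesis
        by (auto simp: q_def cylinder_def exp_sum simp del: prod.lessThan_Suc sum.lessThan_Suc
            intro!: prod.cong)
    next
      case False
      then obtain i where "i < Suc n" "x i \<noteq> case_nat a w i"
        by (auto simp: cylinder_def)
      then have "\<exists>i\<in>{..<Suc (n + k)}. q i (x i) = 0"
        by (intro bexI[of _ i]) (auto simp: q_def)
      then have "(\<Prod>i<Suc (n + k). q i (x i)) = 0"
        by (intro prod_zero) auto
      with False show ?thesis by simp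
    qed
    \<comment> \<open>The partial sums are at most \<open>suminf b\<close>, so a constant dominates
      on a probability space.\<close>
    have lim1: "(\<lambda>k. \<integral>\<^sup>+x. ennreal (\<Prod>i<Suc (n + k). q i (x i)) \<partial>product_measure)
       \<longlonglongrightarrow> (\<integral>\<^sup>+x. ennreal (exp (tail_sum 0 x) * indicator (cylinder (Suc n) (case_nat a w)) x) \<partial>product_measure)"
    proof (rule nn_integral_dominated_convergence[where w = "\<lambda>_. ennreal (exp (suminf b))"])
      show "AE x in product_measure. ennreal (\<Prod>i<Suc (n + k). q i (x i)) \<le> ennreal (exp (suminf b))" for k
        unfolding q using abs_sum[of _ "Suc (n + k)"]
        by (intro AE_I2 ennreal_leI) (auto simp: indicator_def abs_le_iff simp del: sum.lessThan_Suc)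
      show "(\<integral>\<^sup>+x. ennreal (exp (suminf b)) \<partial>product_measure) < \<infinity>"
        using prob_space.emeasure_space_1[OF prob_space_product_measure] by simp
      have "(\<lambda>k. \<Sum>i<Suc (n + k). l i (x i)) \<longlonglongrightarrow> tail_sum 0 x" for x
      proof -
        have "(\<lambda>k. \<Sum>i<k. l i (x i)) \<longlonglongrightarrow> tail_sum 0 x"
          using summable_LIMSEQ[OF summable_l[of 0 x]] by (simp add: tail_sum_def)
        from LIMSEQ_ignore_initial_segment[OF this, of "Suc n"] show ?thesis
          by (simp add: add.commute)
      qed
      then show "AE x in product_measure. (\<lambda>k. ennreal (\<Prod>i<Suc (n + k). q i (x i)))
        \<longlonglongrightarrow> ennreal (exp (tail_sum 0 x) * indicator (cylinder (Suc n) (case_nat a w)) x)"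
        unfolding q by (intro AE_I2 tendsto_ennrealI tendsto_intros)
    qed measurable
    have eq: "(\<integral>\<^sup>+x. ennreal (\<Prod>i<Suc (n + k). q i (x i)) \<partial>product_measure)
        = ennreal ((\<Prod>i<n. marginal i (w i)) / normalizer (n + k))" for k
    proof -
      have "(\<integral>\<^sup>+x. ennreal (\<Prod>i<Suc (n + k). q i (x i)) \<partial>product_measure)
         = ennreal (\<Prod>i<Suc (n + k). \<Sum>c\<in>UNIV. marginal i c * q i c)"
        by (rule product_measure_nn_integral_prod) (simp add: q_def)
      also have "(\<Prod>i<Suc (n + k). \<Sum>c\<in>UNIV. marginal i c * q i c) = (\<Prod>i<min n (n + k). marginal i (w i)) / normalizer (n + k)"
        unfolding q_def by (rule prod_marginal_exp)
      finally show ?thesis by simp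
    qed
    have lim2: "(\<lambda>k. ennreal ((\<Prod>i<n. marginal i (w i)) / normalizer (n + k)))
        \<longlonglongrightarrow> ennreal ((\<Prod>i<n. marginal i (w i)) / L)"
      using LIMSEQ_ignore_initial_segment[OF L(2), of n] L(1)
      by (intro tendsto_ennrealI tendsto_intros) (auto simp: add.commute)
    show ?thesis
      using LIMSEQ_unique[OF lim1[unfolded eq] lim2] by (simp add: ennreal_mult' ennreal_indicator)
  qed
  \<comment> \<open>By \<open>int\<close>, the integral of \<open>pot\<close> over the longer
    cylinder is \<open>s / L\<close> times the mass of \<open>cylinder n w\<close>, whence the
    constant \<open>L / s\<close>.\<close>
  show ?thesis
  proof (rule conformal_measureI[OF prob_space_product_measure sets_product_measure measurable_pot, of "L / s"])
    show "L / s > 0" using L(1) s_pos by simp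
    fix a n w
    have "(\<integral>\<^sup>+x\<in>cylinder (Suc n) (case_nat a w). ennreal (pot x) \<partial>product_measure)
        = ennreal s * (\<integral>\<^sup>+x\<in>cylinder (Suc n) (case_nat a w). ennreal (exp (tail_sum 0 x)) \<partial>product_measure)"
      using s_pos by (subst nn_integral_cmult[symmetric]) (auto simp: pot_def ennreal_mult mult.assoc)
    then show "emeasure product_measure (cylinder n w) =
        ennreal (L / s) * (\<integral>\<^sup>+x\<in>cylinder (Suc n) (case_nat a w). ennreal (pot x) \<partial>product_measure)"
      using L(1) s_pos
      by (simp add: int product_measure_cylinder prod_nonneg marginal_pos less_imp_le flip: ennreal_mult)
  qed
qed

end

section \<open>From the functions \<open>g\<close> to a product potential\<close>

theorem theorem3p3:
  fixes g :: "nat \<Rightarrow> 'a::{finite, discrete_topology} \<Rightarrow> real"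
    and g0 :: real
  assumes pos: "\<And>i a. g i a > 0"
    and const: "\<And>a. g 0 a = g0"
    and summable:
      "(\<Sum>i. \<Sum>k. ennreal (ln (max (sup_norm (g (i + k)))
                                  (sup_norm (\<lambda>a. inverse (g (i + k) a)))))) < \<infinity>"
  shows "(\<exists>!\<mu>. conformal_measure (product_type_function g0 g) \<mu>) \<and>
         (\<forall>\<mu>. conformal_measure (product_type_function g0 g) \<mu> \<longrightarrow> ergodic_measure \<mu>)"
proof -
  define b where "b k = ln (max (sup_norm (g k)) (sup_norm (\<lambda>a. inverse (g k a))))" for k
  have sup: "\<bar>f a\<bar> \<le> sup_norm f" for f :: "'a \<Rightarrow> real" and a
    unfolding sup_norm_def by (rule cSUP_upper) auto
  have ln_le: "\<bar>ln (g k a)\<bar> \<le> b k" for k a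
  proof -
    have "ln (g k a) \<le> b k" "ln (inverse (g k a)) \<le> b k"
      unfolding b_def using pos[of k a] sup[of "g k" a] sup[of "\<lambda>a. inverse (g k a)" a]
      by (auto intro!: ln_mono)
    then show ?thesis using pos[of k a] by (simp add: ln_inverse)
  qed
  \<comment> \<open>\<open>ennreal\<close> sends negative reals to 0, so nonnegativity is what makes
    the extended series speak about \<open>b\<close> itself.\<close>
  then have b_nonneg: "b k \<ge> 0" for k
    by (rule order_trans[OF abs_ge_zero])
  \<comment> \<open>The single series is the term \<open>i = 0\<close> of the double series.\<close>
  have "(\<Sum>k. ennreal (b k)) \<le> (\<Sum>i. \<Sum>k. ennreal (b (i + k)))"
    using sum_le_suminf[of "\<lambda>i. \<Sum>k. ennreal (b (i + k))" "{0}"] by simp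
  then have "(\<Sum>k. ennreal (b k)) < \<infinity>"
    using summable by (simp add: b_def)
  then have "summable b"
    using b_nonneg by (intro summable_suminf_not_top) auto
  then have "summable (\<lambda>k. b (Suc k))"
    by (simp add: summable_Suc_iff)
  \<comment> \<open>The index moves by one because coordinate \<open>x i\<close> is paired with
    \<open>g (Suc i)\<close>; positivity of \<open>g0\<close> comes from \<open>g 0\<close>.\<close>
  then interpret product_potential "\<lambda>i a. ln (g (Suc i) a)" "\<lambda>i. b (Suc i)" g0
    using pos[of 0] const ln_le by unfold_locales auto
  have "product_type_function g0 g x = pot x" for x
  proof -
    have "(\<Prod>i. g (Suc i) (x i)) = (\<Prod>i. exp (ln (g (Suc i) (x i))))"
      using pos by simp
    also have "\<dots> = exp (tail_sum 0 x)"
      using summable_l[of 0 x] by (subst prodinf_exp) (simp_all add: tail_sum_def)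
    finally show ?thesis by (simp add: product_type_function_def pot_def)
  qed
  then have "product_type_function g0 g = pot" by (rule ext)
  then show ?thesis
    using conformal_product_measure conformal_measure_unique conformal_measure_ergodic by metis
qed

end
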